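(* Let $\mathcal L_3 \subset \mathbb C[S_3]$ be the set of Lie elements with respect to the permutation representation $\mathbb C^3$ of $S_3$. Then the elements $1-(12)$, $1-(23)$, $1-(13)$ and $(123)-(132)$ form a basis of $\mathcal L_3$, so that $\dim \mathcal L_3 = 4$. As a representation of $S_3$ (acting by conjugation), $\mathcal L_3$ is the direct sum $V_0 \oplus V_1 \oplus V_2$, where $V_0$ is a trivial representation spanned by $1 - \frac13(12) - \frac13(13) - \frac13(23)$, $V_1$ is a sign representation spanned by $(123)-(132)$, and $V_2$ is a two-dimensional representation spanned by $(12)-(13)$, $(13)-(23)$ and $(23)-(12)$ (these three elements sum to zero, and any two of them form a basis of $V_2$). As a Lie algebra with bracket $[p,q] = pq-qp$, $\mathcal L_3$ is the direct sum of its center, which is $V_0$, and a three-dimensional Lie subalgebra spanned by $V_1 \cup V_2$.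
   Context: Let $V$ be a finite-dimensional representation of a group $G$ over a field $k$. For $g \in G$ and $m \ge 1$ define linear operators $A_m(g), B_m(g): V^{\wedge m} \to V^{\wedge m}$ on the $m$-th exterior power by $$A_m(g)(v_1 \wedge \dots \wedge v_m) = g(v_1) \wedge \dots \wedge g(v_m),$$ $$B_m(g)(v_1 \wedge \dots \wedge v_m) = \sum_{p=1}^m v_1 \wedge \dots \wedge g(v_p) \wedge \dots \wedge v_m$$ (in the $p$-th summand only $v_p$ is replaced by $g(v_p)$). For $m = 0$ set $A_0(g) = 1$ and $B_0(g) = 0$ as operators $k \to k$. Extend $A_m$ and $B_m$ by $k$-linearity to maps $k[G] \to \operatorname{End}(V^{\wedge m})$. An element $x \in k[G]$ is called a Lie element (with respect to $V$) if $A_m(x) = B_m(x)$ for all $m = 0, 1, \dots, \dim V$; the set of Lie elements is denoted $\mathcal L(V)$. For $G = S_n$, $k = \mathbb C$, let $\mathbb C^n$ be the permutation representation: $S_n$ permutes the basis $x_1, \dots, x_n$ by $\sigma(x_i) = x_{\sigma(i)}$. Write $\mathcal L_n = \mathcal L(\mathbb C^n) \subset \mathbb C[S_n]$. The notation $(i_1 \dots i_k) \in S_n$ means the cyclic permutation sending each $i_s$ to $i_{s+1}$ (indices modulo $k$). *)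

theory Defs
  imports
    "HOL-Analysis.Analysis"
    "HOL-Library.Poly_Mapping"
    "HOL-Library.Numeral_Type"
    "HOL-Combinatorics.Permutations"
    "HOL-Combinatorics.Perm"
begin

section \<open>Formal linear combinations\<close>

text \<open>The free \<open>'k\<close>-vector space on a type \<open>'a\<close> is \<open>'a \<Rightarrow>\<^sub>0 'k\<close>.\<close>

definition fscale :: "'k::field \<Rightarrow> ('a \<Rightarrow>\<^sub>0 'k) \<Rightarrow> ('a \<Rightarrow>\<^sub>0 'k)" where
  "fscale c p = Poly_Mapping.map ((*) c) p"

definition formal :: "'a \<Rightarrow> ('a \<Rightarrow>\<^sub>0 'k::field)" where
  "formal a = Poly_Mapping.single a 1"

definition fextend :: "('a \<Rightarrow> ('b \<Rightarrow>\<^sub>0 'k)) \<Rightarrow> ('a \<Rightarrow>\<^sub>0 'k::field) \<Rightarrow> ('b \<Rightarrow>\<^sub>0 'k)" where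
  "fextend f p = (\<Sum>a\<in>Poly_Mapping.keys p. fscale (Poly_Mapping.lookup p a) (f a))"

lemma lookup_fscale [simp]:
  "Poly_Mapping.lookup (fscale c p) a = c * Poly_Mapping.lookup p a"
  by (simp add: fscale_def Poly_Mapping.map.rep_eq when_def)

lemma lookup_formal: "Poly_Mapping.lookup (formal a) b = (if a = b then 1 else 0)"
  by (simp add: formal_def lookup_single when_def)

global_interpretation free: vector_space fscale
  by unfold_locales (auto intro!: poly_mapping_eqI simp: lookup_add algebra_simps)

lemma fextend_superset:
  assumes "finite S" "Poly_Mapping.keys p \<subseteq> S"
  shows "fextend f p = (\<Sum>a\<in>S. fscale (Poly_Mapping.lookup p a) (f a))"
  unfolding fextend_def using assms
  by (intro sum.mono_neutral_left) (auto simp: in_keys_iff)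

lemma fextend_add: "fextend f (p + q) = fextend f p + fextend f q"
proof -
  let ?S = "Poly_Mapping.keys p \<union> Poly_Mapping.keys q"
  have "fextend f (p + q) = (\<Sum>a\<in>?S. fscale (Poly_Mapping.lookup (p + q) a) (f a))"
    by (rule fextend_superset) (use Poly_Mapping.keys_add[of p q] in auto)
  also have "\<dots> = (\<Sum>a\<in>?S. fscale (Poly_Mapping.lookup p a) (f a))
      + (\<Sum>a\<in>?S. fscale (Poly_Mapping.lookup q a) (f a))"
    by (simp add: lookup_add free.scale_left_distrib sum.distrib)
  also have "\<dots> = fextend f p + fextend f q"
    by (subst (1 2) fextend_superset[where S = ?S]) auto
  finally show ?thesis .
qed

lemma fextend_scale: "fextend f (fscale c p) = fscale c (fextend f p)"
proof -
  have "fextend f (fscale c p)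
      = (\<Sum>a\<in>Poly_Mapping.keys p. fscale (Poly_Mapping.lookup (fscale c p) a) (f a))"
    by (rule fextend_superset) (auto simp: in_keys_iff)
  then show ?thesis by (simp add: fextend_def free.scale_sum_right)
qed

global_interpretation fextend: Vector_Spaces.linear fscale fscale "fextend f" for f
  by unfold_locales (auto simp: fextend_add fextend_scale)

lemma fextend_formal [simp]: "fextend f (formal a) = f a"
  by (simp add: fextend_def formal_def)


section \<open>The exterior algebra of \<open>'k ^ 'n\<close>\<close>

text \<open>
  A list \<open>[v\<^sub>1, \<dots>, v\<^sub>m]\<close> stands for the formal product of its entries.  The relations are
  multilinearity in each entry and vanishing on lists with a repeated entry.  They are
  homogeneous in the length, so that the quotient is the direct sum of the exterior powers.
\<close>

definition ext_gens :: "(('k::field ^ 'n) list \<Rightarrow>\<^sub>0 'k) set" where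
  "ext_gens =
     {formal (vs[i := u + v]) - formal (vs[i := u]) - formal (vs[i := v]) | vs i u v.
        i < length vs}
   \<union> {formal (vs[i := c *s u]) - fscale c (formal (vs[i := u])) | vs i c u. i < length vs}
   \<union> {formal vs | vs. \<not> distinct vs}"

definition ext_rel ::
    "(('k::field ^ 'n) list \<Rightarrow>\<^sub>0 'k) \<Rightarrow> (('k ^ 'n) list \<Rightarrow>\<^sub>0 'k) \<Rightarrow> bool" where
  "ext_rel p q \<longleftrightarrow> p - q \<in> free.span ext_gens"

lemma ext_rel_equivp: "equivp (ext_rel :: (('k::field ^ 'n) list \<Rightarrow>\<^sub>0 'k) \<Rightarrow> _)"
proof (rule equivpI)
  show "reflp (ext_rel :: (('k ^ 'n) list \<Rightarrow>\<^sub>0 'k) \<Rightarrow> _)"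
    by (auto simp: reflp_def ext_rel_def free.span_zero)
  show "symp (ext_rel :: (('k ^ 'n) list \<Rightarrow>\<^sub>0 'k) \<Rightarrow> _)"
  proof (rule sympI)
    fix p q :: "('k ^ 'n) list \<Rightarrow>\<^sub>0 'k" assume "ext_rel p q"
    then have "- (p - q) \<in> free.span ext_gens"
      unfolding ext_rel_def by (rule free.span_neg)
    then show "ext_rel q p" by (simp add: ext_rel_def)
  qed
  show "transp (ext_rel :: (('k ^ 'n) list \<Rightarrow>\<^sub>0 'k) \<Rightarrow> _)"
  proof (rule transpI)
    fix p q r :: "('k ^ 'n) list \<Rightarrow>\<^sub>0 'k" assume "ext_rel p q" "ext_rel q r"
    then have "(p - q) + (q - r) \<in> free.span ext_gens"
      unfolding ext_rel_def by (rule free.span_add)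
    then show "ext_rel p r" by (simp add: ext_rel_def)
  qed
qed

quotient_type (overloaded) ('k, 'n) exterior = "('k::field ^ 'n::finite) list \<Rightarrow>\<^sub>0 'k" / ext_rel
  by (rule ext_rel_equivp)

instantiation exterior :: (field, finite) ab_group_add
begin

lift_definition zero_exterior :: "('a, 'b) exterior" is 0 .

lift_definition plus_exterior ::
    "('a, 'b) exterior \<Rightarrow> ('a, 'b) exterior \<Rightarrow> ('a, 'b) exterior" is "(+)"
  unfolding ext_rel_def by (drule (1) free.span_add) (simp add: algebra_simps)

lift_definition uminus_exterior :: "('a, 'b) exterior \<Rightarrow> ('a, 'b) exterior" is uminus
  unfolding ext_rel_def by (drule free.span_neg) simp

lift_definition minus_exterior ::
    "('a, 'b) exterior \<Rightarrow> ('a, 'b) exterior \<Rightarrow> ('a, 'b) exterior" is "(-)"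
  unfolding ext_rel_def by (drule (1) free.span_diff) (simp add: algebra_simps)

instance
proof
  fix a b c :: "('a, 'b) exterior"
  show "a + b + c = a + (b + c)" by transfer (simp add: ext_rel_def free.span_zero add.assoc)
  show "a + b = b + a" by transfer (simp add: ext_rel_def free.span_zero add.commute)
  show "0 + a = a" by transfer (simp add: ext_rel_def free.span_zero)
  show "- a + a = 0" by transfer (simp add: ext_rel_def free.span_zero)
  show "a - b = a + - b" by transfer (simp add: ext_rel_def free.span_zero)
qed

end

lift_definition ext_scale :: "'k::field \<Rightarrow> ('k, 'n::finite) exterior \<Rightarrow> ('k, 'n) exterior"
  is fscale
  unfolding ext_rel_def by (simp add: free.span_scale flip: free.scale_right_diff_distrib)

global_interpretation ext: vector_space ext_scale
proof
  fix a b :: 'a and x y :: "('a, 'b) exterior"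
  show "ext_scale a (x + y) = ext_scale a x + ext_scale a y"
    by transfer (simp add: ext_rel_def free.span_zero free.scale_right_distrib)
  show "ext_scale (a + b) x = ext_scale a x + ext_scale b x"
    by transfer (simp add: ext_rel_def free.span_zero free.scale_left_distrib)
  show "ext_scale a (ext_scale b x) = ext_scale (a * b) x"
    by transfer (simp add: ext_rel_def free.span_zero free.scale_scale)
  show "ext_scale 1 x = x"
    by transfer (simp add: ext_rel_def free.span_zero free.scale_one)
qed

lift_definition wedge :: "('k::field ^ 'n::finite) list \<Rightarrow> ('k, 'n) exterior" is formal .

definition ext_power :: "nat \<Rightarrow> ('k::field, 'n::finite) exterior set" where
  "ext_power m = ext.span (wedge ` {vs. length vs = m})"

lemma ext_gens_add:
  "i < length vs \<Longrightarrow>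
    formal (vs[i := u + v]) - (formal (vs[i := u]) + formal (vs[i := v])) \<in> ext_gens"
  unfolding ext_gens_def diff_diff_eq[symmetric] by (intro UnI1 CollectI exI conjI) auto

lemma ext_gens_scale:
  "i < length vs \<Longrightarrow>
    formal (vs[i := c *s u]) - fscale c (formal (vs[i := u])) \<in> ext_gens"
  unfolding ext_gens_def by (intro UnI1[OF UnI2] CollectI exI conjI) auto

lemma ext_gens_alt: "\<not> distinct vs \<Longrightarrow> formal vs - 0 \<in> ext_gens"
  unfolding ext_gens_def diff_zero by (intro UnI2 CollectI exI conjI) auto

lemma wedge_add:
  "i < length vs \<Longrightarrow> wedge (vs[i := u + v]) = wedge (vs[i := u]) + wedge (vs[i := v])"
  by transfer (unfold ext_rel_def, intro free.span_base ext_gens_add)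

lemma wedge_scale:
  "i < length vs \<Longrightarrow> wedge (vs[i := c *s u]) = ext_scale c (wedge (vs[i := u]))"
  by transfer (unfold ext_rel_def, intro free.span_base ext_gens_scale)

lemma wedge_not_distinct: "\<not> distinct vs \<Longrightarrow> wedge vs = 0"
  by transfer (unfold ext_rel_def, intro free.span_base ext_gens_alt)

lemma wedge_swap:
  assumes ij: "i < length vs" "j < length vs" "i \<noteq> j"
  shows "wedge (vs[i := u, j := v]) + wedge (vs[i := v, j := u]) = 0"
proof -
  have rep: "wedge (vs[i := w, j := w]) = 0" for w
    by (rule wedge_not_distinct) (use ij in \<open>auto simp: distinct_conv_nth nth_list_update\<close>)
  have dist_i: "wedge (vs[i := a + b, j := c]) = wedge (vs[i := a, j := c]) + wedge (vs[i := b, j := c])"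
    for a b c
    using wedge_add[of i "vs[j := c]" a b] ij by (simp add: list_update_swap)
  have dist_j: "wedge (vs[i := c, j := a + b]) = wedge (vs[i := c, j := a]) + wedge (vs[i := c, j := b])"
    for a b c
    using wedge_add[of j "vs[i := c]" a b] ij by simp
  show ?thesis
    using rep[of "u + v"] rep[of u] rep[of v] by (simp add: dist_i dist_j add.commute)
qed

subsection \<open>The operators \<open>A\<close> and \<open>B\<close>\<close>

definition A_formal :: "'k ^ 'n ^ 'n \<Rightarrow> (('k::field ^ 'n) list \<Rightarrow>\<^sub>0 'k) \<Rightarrow> (('k ^ 'n) list \<Rightarrow>\<^sub>0 'k)" where
  "A_formal g = fextend (\<lambda>vs. formal (map ((*v) g) vs))"

definition B_formal :: "'k ^ 'n ^ 'n \<Rightarrow> (('k::field ^ 'n) list \<Rightarrow>\<^sub>0 'k) \<Rightarrow> (('k ^ 'n) list \<Rightarrow>\<^sub>0 'k)" where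
  "B_formal g = fextend (\<lambda>vs. \<Sum>p<length vs. formal (vs[p := g *v (vs ! p)]))"

lemma abs_exterior_eq_0_iff: "abs_exterior p = 0 \<longleftrightarrow> p \<in> free.span ext_gens"
  by (simp add: zero_exterior.abs_eq exterior.abs_eq_iff ext_rel_def)

global_interpretation abs_exterior: Vector_Spaces.linear fscale ext_scale
    "abs_exterior :: (('k::field ^ 'n::finite) list \<Rightarrow>\<^sub>0 'k) \<Rightarrow> _"
  by unfold_locales (simp_all add: plus_exterior.abs_eq ext_scale.abs_eq)

lemma abs_exterior_formal: "abs_exterior (formal vs) = wedge vs"
  by (simp add: wedge.abs_eq)

lemma fextend_respects:
  fixes f :: "('k::field ^ 'n::finite) list \<Rightarrow> (('k ^ 'n) list \<Rightarrow>\<^sub>0 'k)"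
  defines "F \<equiv> \<lambda>vs. abs_exterior (f vs)"
  assumes add: "\<And>vs i u v. i < length vs \<Longrightarrow> F (vs[i := u + v]) = F (vs[i := u]) + F (vs[i := v])"
    and scale: "\<And>vs i c u. i < length vs \<Longrightarrow> F (vs[i := c *s u]) = ext_scale c (F (vs[i := u]))"
    and alt: "\<And>vs. \<not> distinct vs \<Longrightarrow> F vs = 0"
    and pq: "ext_rel p q"
  shows "ext_rel (fextend f p) (fextend f q)"
proof -
  have "fextend f r \<in> free.span ext_gens" if "r \<in> free.span ext_gens" for r
    using that
  proof (induction rule: free.span_induct_alt)
    case base
    then show ?case by (simp add: free.span_zero)
  next
    case (step c x y)
    from step(1) consider
        (a) vs i u v where "i < length vs"
          "x = formal (vs[i := u + v]) - formal (vs[i := u]) - formal (vs[i := v])"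
      | (s) vs i c u where "i < length vs"
          "x = formal (vs[i := c *s u]) - fscale c (formal (vs[i := u]))"
      | (d) vs where "\<not> distinct vs" "x = formal vs"
      unfolding ext_gens_def by (elim UnE CollectE exE conjE)
    then have "abs_exterior (fextend f x) = 0"
    proof cases
      case a
      then show ?thesis using add[of i vs u v]
        by (simp add: F_def fextend.diff abs_exterior.diff)
    next
      case s
      then show ?thesis using scale[of i vs c u]
        by (simp add: F_def fextend.diff fextend_scale abs_exterior.diff abs_exterior.scale)
    next
      case d
      then show ?thesis using alt[of vs] by (simp add: F_def)
    qed
    then show ?case
      using step(2) by (simp add: abs_exterior_eq_0_iff fextend_add fextend_scale
          free.span_add free.span_scale)
  qed
  with pq show ?thesis by (simp add: ext_rel_def fextend.diff[symmetric])
qed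

lift_definition ext_A :: "'k::field ^ 'n::finite ^ 'n \<Rightarrow> ('k, 'n) exterior \<Rightarrow> ('k, 'n) exterior"
  is A_formal
  unfolding A_formal_def
proof (erule fextend_respects[rotated 3], goal_cases)
  case (1 g p q vs i u v)
  then show ?case
    by (simp add: abs_exterior_formal map_update matrix_vector_right_distrib wedge_add)
next
  case (2 g p q vs i c u)
  then show ?case
    by (simp add: abs_exterior_formal map_update vec.scale wedge_scale)
next
  case (3 g p q vs)
  then show ?case
    by (simp add: abs_exterior_formal wedge_not_distinct distinct_map)
qed

lemma B_formal_split:
  assumes "i < length vs"
  shows "abs_exterior (\<Sum>p<length (vs[i := u]). formal (vs[i := u, p := g *v (vs[i := u] ! p)]))
    = wedge (vs[i := g *v u])
      + (\<Sum>p\<in>{..<length vs} - {i}. wedge (vs[p := g *v (vs ! p), i := u]))"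
proof -
  have "abs_exterior (\<Sum>p<length (vs[i := u]). formal (vs[i := u, p := g *v (vs[i := u] ! p)]))
      = (\<Sum>p<length vs. wedge (vs[i := u, p := g *v (vs[i := u] ! p)]))"
    by (simp add: abs_exterior.sum abs_exterior_formal)
  also have "\<dots> = wedge (vs[i := g *v u])
      + (\<Sum>p\<in>{..<length vs} - {i}. wedge (vs[i := u, p := g *v (vs[i := u] ! p)]))"
    using assms by (subst sum.remove[of _ i]) auto
  also have "(\<Sum>p\<in>{..<length vs} - {i}. wedge (vs[i := u, p := g *v (vs[i := u] ! p)]))
      = (\<Sum>p\<in>{..<length vs} - {i}. wedge (vs[p := g *v (vs ! p), i := u]))"
    by (rule sum.cong) (auto simp: list_update_swap)
  finally show ?thesis .
qed

lemma B_formal_alt: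
  assumes "\<not> distinct vs"
  shows "abs_exterior (\<Sum>p<length vs. formal (vs[p := g *v (vs ! p)])) = 0"
proof -
  from assms obtain i j where ij: "i < length vs" "j < length vs" "i \<noteq> j" "vs ! i = vs ! j"
    by (auto simp: distinct_conv_nth)
  let ?w = "\<lambda>p. wedge (vs[p := g *v (vs ! p)])"
  have "abs_exterior (\<Sum>p<length vs. formal (vs[p := g *v (vs ! p)])) = (\<Sum>p<length vs. ?w p)"
    by (simp add: abs_exterior.sum abs_exterior_formal)
  also have "\<dots> = (\<Sum>p\<in>{i, j}. ?w p)"
  proof (rule sum.mono_neutral_right)
    show "\<forall>p\<in>{..<length vs} - {i, j}. ?w p = 0"
    proof
      fix p assume "p \<in> {..<length vs} - {i, j}"
      then have "\<not> distinct (vs[p := g *v (vs ! p)])"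
        using ij by (metis DiffE insertCI length_list_update nth_eq_iff_index_eq nth_list_update_neq)
      then show "?w p = 0" by (rule wedge_not_distinct)
    qed
  qed (use ij in auto)
  also have "\<dots> = 0"
    using wedge_swap[OF ij(1-3), of "g *v (vs ! i)" "vs ! i"] ij
    by simp (metis list_update_id list_update_swap)
  finally show ?thesis .
qed

lift_definition ext_B :: "'k::field ^ 'n::finite ^ 'n \<Rightarrow> ('k, 'n) exterior \<Rightarrow> ('k, 'n) exterior"
  is B_formal
  unfolding B_formal_def
proof (erule fextend_respects[rotated 3], goal_cases)
  case (1 g p q vs i u v)
  then show ?case
    by (simp only: B_formal_split)
      (simp add: matrix_vector_right_distrib wedge_add sum.distrib)
next
  case (2 g p q vs i c u)
  then show ?case
    by (simp only: B_formal_split)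
      (simp add: vec.scale wedge_scale ext.scale_right_distrib ext.scale_sum_right)
next
  case (3 g p q vs)
  then show ?case by (rule B_formal_alt)
qed

text \<open>\<open>ext_A g\<close> and \<open>ext_B g\<close> are the linear operators on the whole exterior algebra which
  restrict to \<open>A\<^sub>m(g)\<close> and \<open>B\<^sub>m(g)\<close> on \<open>ext_power m\<close>, including \<open>m = 0\<close>.\<close>

global_interpretation ext_A: Vector_Spaces.linear ext_scale ext_scale "ext_A g" for g
  by unfold_locales
    (transfer; simp add: A_formal_def fextend_add fextend_scale ext_rel_def free.span_zero)+

global_interpretation ext_B: Vector_Spaces.linear ext_scale ext_scale "ext_B g" for g
  by unfold_locales
    (transfer; simp add: B_formal_def fextend_add fextend_scale ext_rel_def free.span_zero)+

lemma ext_A_wedge: "ext_A g (wedge vs) = wedge (map ((*v) g) vs)"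
  by (simp add: abs_exterior_formal[symmetric] ext_A.abs_eq A_formal_def)

lemma ext_B_wedge: "ext_B g (wedge vs) = (\<Sum>p<length vs. wedge (vs[p := g *v (vs ! p)]))"
  by (simp add: abs_exterior_formal[symmetric] ext_B.abs_eq B_formal_def abs_exterior.sum)


section \<open>Group algebras and Lie elements\<close>

text \<open>The group algebra of a finite group \<open>'g\<close> is \<open>'k ^ 'g\<close>, with \<open>x $ g\<close> the coefficient of
  \<open>x\<close> at \<open>g\<close>.  The library's multiplication \<open>(*)\<close> and unit \<open>1\<close> on this type are pointwise and
  are not used.\<close>

type_synonym ('k, 'g) galg = "('k, 'g) vec"

definition gelem :: "'g::finite \<Rightarrow> ('k::{zero, one}, 'g) galg" where
  "gelem g = axis g 1"

definition gmult ::
    "('k::comm_ring_1, 'g::{finite, times}) galg \<Rightarrow> ('k, 'g) galg \<Rightarrow> ('k, 'g) galg"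
    (infixl \<open>\<star>\<close> 70) where
  "x \<star> y = (\<chi> g. \<Sum>(h, k)\<in>{(h, k). h * k = g}. x $ h * y $ k)"

lemma gelem_gmult: "gelem g \<star> gelem h = gelem (g * h)"
proof -
  have "(\<Sum>(a, b)\<in>{(a, b). a * b = k}. axis g 1 $ a * axis h 1 $ b)
      = (\<Sum>(a, b)\<in>{(a, b). a * b = k} \<inter> {(g, h)}. 1 :: 'k::comm_ring_1)" for k
    by (rule sum.mono_neutral_cong_right) (auto simp: axis_def split: if_splits)
  also have "\<dots> k = axis (g * h) 1 $ k" for k
    by (auto simp: axis_def)
  finally show ?thesis
    unfolding gmult_def gelem_def vec_eq_iff vec_lambda_beta by blast
qed

definition bracket ::
    "('k::comm_ring_1, 'g::{finite, times}) galg \<Rightarrow> ('k, 'g) galg \<Rightarrow> ('k, 'g) galg" where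
  "bracket x y = x \<star> y - y \<star> x"

definition conj_act ::
    "'g::{finite, times, inverse} \<Rightarrow> ('k::comm_ring_1, 'g) galg \<Rightarrow> ('k, 'g) galg" where
  "conj_act g x = gelem g \<star> x \<star> gelem (inverse g)"

text \<open>Here \<open>\<rho>\<close> is a representation of \<open>'g\<close> on \<open>'k ^ 'n\<close> by matrices; \<open>alg_A\<close> and \<open>alg_B\<close>
  extend \<open>ext_A\<close> and \<open>ext_B\<close> linearly to the group algebra.\<close>

definition alg_A ::
    "('g::finite \<Rightarrow> 'k::field ^ 'n ^ 'n) \<Rightarrow> ('k, 'g) galg \<Rightarrow> ('k, 'n) exterior \<Rightarrow> ('k, 'n) exterior" where
  "alg_A \<rho> x w = (\<Sum>g\<in>UNIV. ext_scale (x $ g) (ext_A (\<rho> g) w))"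

definition alg_B ::
    "('g::finite \<Rightarrow> 'k::field ^ 'n ^ 'n) \<Rightarrow> ('k, 'g) galg \<Rightarrow> ('k, 'n) exterior \<Rightarrow> ('k, 'n) exterior" where
  "alg_B \<rho> x w = (\<Sum>g\<in>UNIV. ext_scale (x $ g) (ext_B (\<rho> g) w))"

definition lie_elements :: "('g::finite \<Rightarrow> 'k::field ^ 'n ^ 'n) \<Rightarrow> ('k, 'g) galg set" where
  "lie_elements \<rho> = {x. \<forall>m \<le> CARD('n). \<forall>w \<in> ext_power m. alg_A \<rho> x w = alg_B \<rho> x w}"


section \<open>The symmetric group and its permutation representation\<close>

instance perm :: (finite) finite
proof
  have "inj (apply :: 'a perm \<Rightarrow> 'a \<Rightarrow> 'a)"
    by (auto simp: inj_def intro: perm_eqI)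
  then show "finite (UNIV :: 'a perm set)"
    using finite_imageD[of "apply :: 'a perm \<Rightarrow> 'a \<Rightarrow> 'a" UNIV] by simp
qed

definition perm_rep :: "'n perm \<Rightarrow> 'k::field ^ 'n ^ 'n" where
  "perm_rep \<sigma> = (\<chi> i j. if i = apply \<sigma> j then 1 else 0)"

lemma perm_rep_axis: "(perm_rep \<sigma> :: 'k::field ^ 'n ^ 'n) *v axis i 1 = axis (apply \<sigma> i) 1"
proof -
  have "(perm_rep \<sigma> *v axis i 1) $ k
      = (\<Sum>j\<in>UNIV. if j = i then if k = apply \<sigma> j then 1 else 0 else (0 :: 'k))" for k
    unfolding matrix_vector_mult_def perm_rep_def axis_def vec_lambda_beta
    by (rule sum.cong) auto
  then show ?thesis by (auto simp: vec_eq_iff axis_def)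
qed

lemma perm_rep_times: "(perm_rep (\<sigma> * \<tau>) :: 'k::field ^ 'n ^ 'n) = perm_rep \<sigma> ** perm_rep \<tau>"
proof -
  have "(perm_rep \<sigma> ** perm_rep \<tau>) $ i $ k
      = (\<Sum>j\<in>UNIV. if j = apply \<tau> k then if i = apply \<sigma> j then 1 else 0 else (0 :: 'k))" for i k
    unfolding matrix_matrix_mult_def perm_rep_def vec_lambda_beta
    by (rule sum.cong) auto
  then show ?thesis by (auto simp: vec_eq_iff perm_rep_def apply_times)
qed

definition perm_lie :: "(complex, 'n::finite perm) galg set" where
  "perm_lie = lie_elements perm_rep"

text \<open>\<open>cyc [i\<^sub>1, \<dots>, i\<^sub>k]\<close> is the basis element of the group algebra given by the cycle
  sending \<open>i\<^sub>s\<close> to \<open>i\<^sub>s\<^sub>+\<^sub>1\<close>.\<close>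

definition cyc :: "'n list \<Rightarrow> (complex, 'n::finite perm) galg" where
  "cyc is = gelem (Perm.cycle is)"


section \<open>Bases, direct sums, representations and Lie algebras\<close>

definition is_basis :: "('k::field, 'g::finite) galg set \<Rightarrow> ('k, 'g) galg set \<Rightarrow> bool" where
  "is_basis B W \<longleftrightarrow> vec.independent B \<and> vec.span B = W"

definition direct_sum :: "('k::field, 'g::finite) galg set \<Rightarrow> ('k, 'g) galg set list \<Rightarrow> bool" where
  "direct_sum W Us \<longleftrightarrow>
     (\<forall>U\<in>set Us. vec.subspace U) \<and> bij_betw sum_list (listset Us) W"

text \<open>\<open>listset Us\<close> is the product of the members of \<open>Us\<close>: every element of \<open>W\<close> is a sum of
  exactly one choice of vectors from them.\<close>

definition conj_subrep :: "('k::field, 'g::{finite, times, inverse}) galg set \<Rightarrow> bool" where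
  "conj_subrep U \<longleftrightarrow> vec.subspace U \<and> (\<forall>g. \<forall>x\<in>U. conj_act g x \<in> U)"

definition lie_subalgebra :: "('k::field, 'g::{finite, times}) galg set \<Rightarrow> bool" where
  "lie_subalgebra U \<longleftrightarrow> vec.subspace U \<and> (\<forall>x\<in>U. \<forall>y\<in>U. bracket x y \<in> U)"

definition lie_center :: "('k::field, 'g::{finite, times}) galg set \<Rightarrow> ('k, 'g) galg set" where
  "lie_center W = {z\<in>W. \<forall>x\<in>W. bracket z x = 0}"

definition lie_direct_sum ::
    "('k::field, 'g::{finite, times}) galg set \<Rightarrow> ('k, 'g) galg set list \<Rightarrow> bool" where
  "lie_direct_sum W Us \<longleftrightarrow>
     direct_sum W Us \<and> (\<forall>U\<in>set Us. lie_subalgebra U) \<and>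
     (\<forall>i<length Us. \<forall>j<length Us. i \<noteq> j \<longrightarrow> (\<forall>x\<in>Us ! i. \<forall>y\<in>Us ! j. bracket x y = 0))"


section \<open>The case of three letters\<close>

text \<open>The elements of the numeral type \<open>3\<close> are \<open>1\<close>, \<open>2\<close> and \<open>3 = 0\<close>.\<close>

definition L3 :: "(complex, 3 perm) galg set" where
  "L3 = perm_lie"

definition V0 :: "(complex, 3 perm) galg set" where
  "V0 = vec.span {gelem 1 - (1/3) *s cyc [1, 2] - (1/3) *s cyc [1, 3] - (1/3) *s cyc [2, 3]}"

definition V1 :: "(complex, 3 perm) galg set" where
  "V1 = vec.span {cyc [1, 2, 3] - cyc [1, 3, 2]}"

definition V2 :: "(complex, 3 perm) galg set" where
  "V2 = vec.span {cyc [1, 2] - cyc [1, 3], cyc [1, 3] - cyc [2, 3], cyc [2, 3] - cyc [1, 2]}"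

end

(*
  A transposition acts on the permutation representation as v - f(v) r for a linear form f and
  a vector r.  When g v_1 ^ ... ^ g v_m is expanded, every term containing r twice vanishes, so
  A(1) - A(g) = B(1) - B(g): hence 1 - (ij) is a Lie element.  Since A is multiplicative and B
  turns commutators into commutators, Lie elements are closed under the bracket, and
  [1 - (12), 1 - (23)] = (123) - (132).  Conversely, applying A = B to x_1 ^ x_2 and reading
  off the coordinates at x_1 ^ x_2 and x_1 ^ x_3 yields two independent linear conditions
  on the six coefficients, so that these four elements span everything.
*)
theory Submission
  imports Defs
begin

section \<open>Operators on the exterior algebra\<close>

text \<open>Wedges of \<open>m\<close> vectors span \<open>ext_power m\<close>, so every operator
  identity below reduces to a computation on single wedges.\<close>

lemma ext_linear_eq_on_power:
  fixes S T :: "('k::field, 'n::finite) exterior \<Rightarrow> ('k, 'n) exterior"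
  assumes "Vector_Spaces.linear ext_scale ext_scale S" "Vector_Spaces.linear ext_scale ext_scale T"
    and "w \<in> ext_power m"
    and "\<And>vs. length vs = m \<Longrightarrow> S (wedge vs) = T (wedge vs)"
  shows "S w = T w"
proof -
  interpret vector_space_pair "ext_scale :: 'k \<Rightarrow> _ \<Rightarrow> ('k, 'n) exterior"
    "ext_scale :: 'k \<Rightarrow> _ \<Rightarrow> ('k, 'n) exterior" ..
  show ?thesis
    using assms by (intro linear_eq_on[of S T w "wedge ` {vs. length vs = m}"])
      (auto simp: ext_power_def)
qed

lemma linear_ext_A_compose:
  "Vector_Spaces.linear ext_scale ext_scale (\<lambda>w. ext_A g (ext_A h w))"
  by unfold_locales (simp_all add: ext_A.add ext_A.scale)

lemma wedge_in_ext_power: "length vs = m \<Longrightarrow> wedge vs \<in> ext_power m"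
  unfolding ext_power_def by (auto intro: ext.span_base)

text \<open>Keeps B(y)w in the same degree, so that A = B may be applied to it once more when
  brackets are formed.\<close>

lemma ext_B_in_ext_power:
  assumes "w \<in> ext_power m"
  shows "ext_B g w \<in> ext_power m"
  using assms unfolding ext_power_def
proof (induction rule: ext.span_induct_alt)
  case (step c x y)
  then obtain vs where "length vs = m" "x = wedge vs" by auto
  then have "ext_B g x \<in> ext_power m"
    by (auto simp: ext_B_wedge ext_power_def intro!: ext.span_sum intro: ext.span_base)
  with step show ?case
    by (simp add: ext_B.add ext_B.scale ext.span_add ext.span_scale ext_power_def)
qed (simp add: ext.span_zero)

lemma ext_A_mult:
  assumes "w \<in> ext_power m"
  shows "ext_A (g ** h) w = ext_A g (ext_A h w)"
  by (rule ext_linear_eq_on_power[OF ext_A.linear_axioms linear_ext_A_compose assms])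
    (simp add: ext_A_wedge comp_def matrix_vector_mul_assoc)

text \<open>Either \<open>g\<close> and \<open>h\<close> hit the same factor, which sums to B(gh),
  or they hit two different factors \<open>p\<close> and \<open>q\<close>.\<close>

lemma ext_B_ext_B_wedge:
  "ext_B g (ext_B h (wedge vs)) = ext_B (g ** h) (wedge vs)
    + (\<Sum>p<length vs. \<Sum>q\<in>{..<length vs} - {p}. wedge (vs[p := h *v (vs ! p), q := g *v (vs ! q)]))"
proof -
  let ?n = "length vs"
  have "(\<Sum>q<?n. wedge (vs[p := h *v (vs ! p), q := g *v (vs[p := h *v (vs ! p)] ! q)]))
      = wedge (vs[p := (g ** h) *v (vs ! p)])
        + (\<Sum>q\<in>{..<?n} - {p}. wedge (vs[p := h *v (vs ! p), q := g *v (vs ! q)]))"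
    if "p < ?n" for p
    using that by (subst sum.remove[of _ p]) (simp_all add: matrix_vector_mul_assoc)
  then show ?thesis
    by (simp add: ext_B_wedge ext_B.sum sum.distrib)
qed

text \<open>The terms of \<open>B(g) B(h)\<close> in which \<open>g\<close> and \<open>h\<close> act on different factors are symmetric
  in \<open>g\<close> and \<open>h\<close>.\<close>

lemma ext_B_commutator:
  assumes "w \<in> ext_power m"
  shows "ext_B g (ext_B h w) - ext_B h (ext_B g w) = ext_B (g ** h) w - ext_B (h ** g) w"
proof (rule ext_linear_eq_on_power[OF _ _ assms])
  show "ext_B g (ext_B h (wedge vs)) - ext_B h (ext_B g (wedge vs))
      = ext_B (g ** h) (wedge vs) - ext_B (h ** g) (wedge vs)" for vs
  proof -
    let ?n = "length vs"
    let ?S = "\<lambda>g h. \<Sum>p<?n. \<Sum>q\<in>{..<?n} - {p}. wedge (vs[p := h *v (vs ! p), q := g *v (vs ! q)])"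
    have "?S g h = (\<Sum>p<?n. \<Sum>q\<in>{..<?n} - {p}. wedge (vs[q := g *v (vs ! q), p := h *v (vs ! p)]))"
      by (intro sum.cong refl) (simp add: list_update_swap)
    also have "\<dots> = (\<Sum>p<?n. \<Sum>q | q \<in> {..<?n} \<and> p \<noteq> q.
        wedge (vs[q := g *v (vs ! q), p := h *v (vs ! p)]))"
      by (intro sum.cong) auto
    also have "\<dots> = (\<Sum>q<?n. \<Sum>p | p \<in> {..<?n} \<and> p \<noteq> q.
        wedge (vs[q := g *v (vs ! q), p := h *v (vs ! p)]))"
      by (rule sum.swap_restrict) auto
    also have "\<dots> = ?S h g"
      by (intro sum.cong) auto
    finally show ?thesis
      by (simp add: ext_B_ext_B_wedge)
  qed
qed (unfold_locales; simp add: ext_B.add ext_B.scale ext.scale_right_diff_distrib)+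

section \<open>Reflections\<close>

text \<open>The factors are replaced by their images one at a time. The prefix \<open>xs\<close> is
  arbitrary because the induction must also run with \<open>r\<close> moved into it.\<close>

lemma wedge_append_diff:
  assumes g: "\<And>v. g *v v = v - f v *s r"
  shows "wedge (xs @ ys) - wedge (xs @ map ((*v) g) ys)
    = (\<Sum>p<length ys. ext_scale (f (ys ! p)) (wedge (xs @ ys[p := r])))"
proof (induction ys arbitrary: xs)
  case (Cons y ys)
  have "wedge (xs @ r # ys) - wedge (xs @ r # map ((*v) g) ys)
      = (\<Sum>p<length ys. ext_scale (f (ys ! p)) (wedge ((xs @ [r]) @ ys[p := r])))"
    using Cons.IH[of "xs @ [r]"] by simp
  \<comment> \<open>Each summand contains \<open>r\<close> twice, once in the prefix and once at
    \<open>p\<close>. So behind a factor \<open>r\<close> the map \<open>g\<close> acts as the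
    identity.\<close>
  also have "\<dots> = 0"
    by (intro sum.neutral ballI) (auto simp: wedge_not_distinct set_update_memI)
  finally have r: "wedge (xs @ r # map ((*v) g) ys) = wedge (xs @ r # ys)"
    by simp
  have "wedge (xs @ (g *v y) # map ((*v) g) ys)
      = wedge (xs @ y # map ((*v) g) ys) + ext_scale (- f y) (wedge (xs @ r # map ((*v) g) ys))"
    using wedge_add[of "length xs" "xs @ y # map ((*v) g) ys" y "(- f y) *s r"]
      wedge_scale[of "length xs" "xs @ y # map ((*v) g) ys" "- f y" r]
    by (simp add: g)
  then show ?case
    using Cons.IH[of "xs @ [y]"] by (simp add: r sum.lessThan_Suc_shift del: sum.lessThan_Suc)
qed simp

text \<open>On a wedge both sides are the sum over \<open>p\<close> of \<open>f (vs ! p)\<close>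
  times the wedge with \<open>r\<close> in place \<open>p\<close>: for A by
  \<open>wedge_append_diff\<close>, for B by linearity in one factor.\<close>

lemma ext_one_minus_reflection:
  assumes g: "\<And>v. g *v v = v - f v *s r" and w: "w \<in> ext_power m"
  shows "ext_A (mat 1) w - ext_A g w = ext_B (mat 1) w - ext_B g w"
proof (rule ext_linear_eq_on_power[OF _ _ w])
  show "ext_A (mat 1) (wedge vs) - ext_A g (wedge vs)
      = ext_B (mat 1) (wedge vs) - ext_B g (wedge vs)" for vs
  proof -
    have "wedge (vs[p := g *v (vs ! p)]) = wedge vs - ext_scale (f (vs ! p)) (wedge (vs[p := r]))"
      if "p < length vs" for p
      using wedge_add[OF that, of "vs ! p" "(- f (vs ! p)) *s r"]
        wedge_scale[OF that, of "- f (vs ! p)" r]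
      by (simp add: g)
    then have "ext_B (mat 1) (wedge vs) - ext_B g (wedge vs)
        = (\<Sum>p<length vs. ext_scale (f (vs ! p)) (wedge (vs[p := r])))"
      by (simp add: ext_B_wedge flip: sum_subtractf)
    moreover have "map ((*v) (mat 1)) vs = vs"
      by (simp add: map_idI)
    ultimately show ?thesis
      using wedge_append_diff[OF g, of "[]" vs] by (simp add: ext_A_wedge)
  qed
qed (unfold_locales;
  simp add: ext_A.add ext_A.scale ext_B.add ext_B.scale ext.scale_right_diff_distrib)+

section \<open>Linear forms on the exterior algebra\<close>

text \<open>The universal property of the exterior algebra: the linear extension of \<open>F\<close>
  to formal combinations kills the relations and hence descends to the quotient.\<close>

lemma alternating_functional:
  fixes F :: "('k::field ^ 'n::finite) list \<Rightarrow> 'k"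
  assumes add: "\<And>vs i u v. i < length vs \<Longrightarrow> F (vs[i := u + v]) = F (vs[i := u]) + F (vs[i := v])"
    and scale: "\<And>vs i c u. i < length vs \<Longrightarrow> F (vs[i := c *s u]) = c * F (vs[i := u])"
    and alt: "\<And>vs. \<not> distinct vs \<Longrightarrow> F vs = 0"
  obtains \<phi> where "Vector_Spaces.linear ext_scale (*) \<phi>" "\<And>vs. \<phi> (wedge vs) = F vs"
proof -
  \<comment> \<open>\<open>fextend\<close> takes values in a free space, so scalars are encoded as
    the free space on the one-point type.\<close>
  define \<psi> where "\<psi> p = Poly_Mapping.lookup (fextend (\<lambda>vs. Poly_Mapping.single () (F vs)) p) ()" for p
  have \<psi>_add: "\<psi> (p + q) = \<psi> p + \<psi> q" and \<psi>_diff: "\<psi> (p - q) = \<psi> p - \<psi> q"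
    and \<psi>_scale: "\<psi> (fscale c p) = c * \<psi> p" and \<psi>_formal: "\<psi> (formal vs) = F vs" for p q c vs
    by (simp_all add: \<psi>_def fextend_add fextend.diff fextend_scale lookup_add lookup_minus)
  have \<psi>_0: "\<psi> 0 = 0"
    using \<psi>_diff[of 0 0] by simp
  have null: "\<psi> p = 0" if "p \<in> free.span ext_gens" for p
    using that
  proof (induction rule: free.span_induct_alt)
    case (step c x y)
    from step(1) have "\<psi> x = 0"
      unfolding ext_gens_def
      by (elim UnE CollectE exE conjE) (simp_all add: \<psi>_diff \<psi>_scale \<psi>_formal add scale alt)
    with step show ?case by (simp add: \<psi>_add \<psi>_scale)
  qed (simp add: \<psi>_0)
  have resp: "\<psi> p = \<psi> q" if "abs_exterior p = abs_exterior q" for p q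
  proof -
    have "p - q \<in> free.span ext_gens"
      unfolding abs_exterior_eq_0_iff[symmetric] by (simp add: abs_exterior.diff that)
    then show ?thesis
      using null[of "p - q"] by (simp only: \<psi>_diff right_minus_eq)
  qed
  \<comment> \<open>By \<open>resp\<close> the value does not depend on the representative that is
    chosen.\<close>
  define \<phi> where "\<phi> w = \<psi> (rep_exterior w)" for w
  have \<phi>_abs: "\<phi> (abs_exterior p) = \<psi> p" for p
    unfolding \<phi>_def by (rule resp) (rule Quotient3_abs_rep[OF Quotient3_exterior])
  show ?thesis
  proof
    show "Vector_Spaces.linear ext_scale (*) \<phi>"
    proof
      show "\<phi> (x + y) = \<phi> x + \<phi> y" for x y
        by (induction x rule: exterior.abs_induct, induction y rule: exterior.abs_induct) (simp add: abs_exterior.add[symmetric] \<phi>_abs \<psi>_add)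
      show "\<phi> (ext_scale c x) = c * \<phi> x" for c x
        by (induction x rule: exterior.abs_induct) (simp add: abs_exterior.scale[symmetric] \<phi>_abs \<psi>_scale)
    qed
    show "\<phi> (wedge vs) = F vs" for vs
      by (simp add: abs_exterior_formal[symmetric] \<phi>_abs \<psi>_formal)
  qed
qed

text \<open>For \<open>i\<close> different from \<open>j\<close> this 2 x 2 minor is the coordinate
  at x_i \<and> x_j; it serves to read off scalar equations from A = B.\<close>

lemma minor_functional:
  obtains \<phi> :: "('k::field, 'n::finite) exterior \<Rightarrow> 'k"
  where "Vector_Spaces.linear ext_scale (*) \<phi>"
    "\<And>u v. \<phi> (wedge [u, v]) = u $ i * v $ j - u $ j * v $ i"
proof -
  \<comment> \<open>The value 0 in the other lengths is compatible with multilinearity, since list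
    updates preserve the length.\<close>
  define F :: "('k ^ 'n) list \<Rightarrow> 'k" where
    "F vs = (if length vs = 2 then vs ! 0 $ i * vs ! 1 $ j - vs ! 0 $ j * vs ! 1 $ i else 0)" for vs
  obtain \<phi> where "Vector_Spaces.linear ext_scale (*) \<phi>" "\<And>vs. \<phi> (wedge vs) = F vs"
  proof (rule alternating_functional[of F])
    show "F (vs[k := u + v]) = F (vs[k := u]) + F (vs[k := v])" if "k < length vs" for vs k u v
      using that by (auto simp: F_def nth_list_update less_2_cases_iff algebra_simps)
    show "F (vs[k := c *s u]) = c * F (vs[k := u])" if "k < length vs" for vs k c u
      using that by (auto simp: F_def nth_list_update less_2_cases_iff algebra_simps)
    show "F vs = 0" if "\<not> distinct vs" for vs
      using that by (auto simp: F_def distinct_conv_nth less_2_cases_iff)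
  qed blast
  then show ?thesis
    by (intro that[of \<phi>]) (auto simp: F_def)
qed


section \<open>Lie elements of a group algebra\<close>

lemma alg_A_gelem [simp]: "alg_A \<rho> (gelem g) w = ext_A (\<rho> g) w"
proof -
  have "alg_A \<rho> (gelem g) w = (\<Sum>h\<in>UNIV. if h = g then ext_A (\<rho> h) w else 0)"
    unfolding alg_A_def gelem_def axis_def by (rule sum.cong) auto
  then show ?thesis by simp
qed

lemma alg_B_gelem [simp]: "alg_B \<rho> (gelem g) w = ext_B (\<rho> g) w"
proof -
  have "alg_B \<rho> (gelem g) w = (\<Sum>h\<in>UNIV. if h = g then ext_B (\<rho> h) w else 0)"
    unfolding alg_B_def gelem_def axis_def by (rule sum.cong) auto
  then show ?thesis by simp
qed

lemma alg_A_diff: "alg_A \<rho> (x - y) w = alg_A \<rho> x w - alg_A \<rho> y w"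
  by (simp add: alg_A_def ext.scale_left_diff_distrib sum_subtractf)

lemma alg_B_diff: "alg_B \<rho> (x - y) w = alg_B \<rho> x w - alg_B \<rho> y w"
  by (simp add: alg_B_def ext.scale_left_diff_distrib sum_subtractf)

lemma subspace_lie_elements: "vec.subspace (lie_elements \<rho>)"
  by (auto simp: vec.subspace_def lie_elements_def alg_A_def alg_B_def ext.scale_left_distrib
      sum.distrib simp flip: ext.scale_scale ext.scale_sum_right)

lemma alg_B_in_ext_power:
  assumes "w \<in> ext_power m"
  shows "alg_B \<rho> x w \<in> ext_power m"
  using ext_B_in_ext_power[OF assms] unfolding alg_B_def
  by (simp add: ext_power_def ext.span_sum ext.span_scale)

text \<open>Sorting the pairs \<open>(h, k)\<close> by their product turns the convolution into a
  free double sum; \<open>F\<close> will be an operator applied to a fixed vector.\<close>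

lemma sum_gmult:
  fixes x y :: "('k::field, 'g::{finite, times}) galg"
    and F :: "'g \<Rightarrow> ('k, 'n::finite) exterior"
  shows "(\<Sum>g\<in>UNIV. ext_scale ((x \<star> y) $ g) (F g))
    = (\<Sum>h\<in>UNIV. \<Sum>k\<in>UNIV. ext_scale (x $ h * y $ k) (F (h * k)))"
proof -
  have "(\<Sum>g\<in>UNIV. ext_scale ((x \<star> y) $ g) (F g))
      = (\<Sum>g\<in>UNIV. \<Sum>(h, k) | (h, k) \<in> UNIV \<and> h * k = g. ext_scale (x $ h * y $ k) (F (h * k)))"
    by (auto simp: gmult_def ext.scale_sum_left intro!: sum.cong)
  also have "\<dots> = (\<Sum>(h, k)\<in>UNIV. ext_scale (x $ h * y $ k) (F (h * k)))"
    using sum.group[of "UNIV :: ('g \<times> 'g) set" UNIV "\<lambda>(h, k). h * k"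
        "\<lambda>(h, k). ext_scale (x $ h * y $ k) (F (h * k))"]
    by (simp add: case_prod_unfold)
  finally show ?thesis
    by (simp add: sum.cartesian_product)
qed

lemma alg_A_gmult:
  assumes \<rho>: "\<And>g h. \<rho> (g * h) = \<rho> g ** \<rho> h" and w: "w \<in> ext_power m"
  shows "alg_A \<rho> (x \<star> y) w = alg_A \<rho> x (alg_A \<rho> y w)"
  unfolding alg_A_def[of \<rho> "x \<star> y"] sum_gmult \<rho> ext_A_mult[OF w]
  by (simp add: alg_A_def ext_A.sum ext_A.scale ext.scale_sum_right)

lemma alg_B_alg_B:
  "alg_B \<rho> x (alg_B \<rho> y w)
    = (\<Sum>h\<in>UNIV. \<Sum>k\<in>UNIV. ext_scale (x $ h * y $ k) (ext_B (\<rho> h) (ext_B (\<rho> k) w)))"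
  by (simp add: alg_B_def ext_B.sum ext_B.scale ext.scale_sum_right)

lemma alg_B_bracket:
  assumes \<rho>: "\<And>g h. \<rho> (g * h) = \<rho> g ** \<rho> h" and w: "w \<in> ext_power m"
  shows "alg_B \<rho> (bracket x y) w = alg_B \<rho> x (alg_B \<rho> y w) - alg_B \<rho> y (alg_B \<rho> x w)"
proof -
  \<comment> \<open>Renaming the indices gives both products the coefficients
    \<open>x $ h * y $ k\<close>, so the commutator rule applies to each pair.\<close>
  have swap: "(\<Sum>h\<in>UNIV. \<Sum>k\<in>UNIV. ext_scale (y $ h * x $ k) (F h k))
      = (\<Sum>h\<in>UNIV. \<Sum>k\<in>UNIV. ext_scale (x $ h * y $ k) (F k h))" for F
    by (subst sum.swap) (simp add: mult.commute)
  have "alg_B \<rho> (bracket x y) w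
      = (\<Sum>h\<in>UNIV. \<Sum>k\<in>UNIV. ext_scale (x $ h * y $ k)
          (ext_B (\<rho> h ** \<rho> k) w - ext_B (\<rho> k ** \<rho> h) w))"
    unfolding bracket_def alg_B_diff
    by (simp only: alg_B_def sum_gmult \<rho> swap ext.scale_right_diff_distrib sum_subtractf)
  then show ?thesis
    unfolding alg_B_alg_B swap
    by (simp add: ext_B_commutator[OF w, symmetric] ext.scale_right_diff_distrib sum_subtractf)
qed

text \<open>A turns products into compositions and B turns brackets into commutators; on Lie
  elements the two commutators agree.\<close>

lemma bracket_lie_elements:
  fixes \<rho> :: "'g::{finite, times} \<Rightarrow> 'k::field ^ 'n::finite ^ 'n"
  assumes \<rho>: "\<And>g h. \<rho> (g * h) = \<rho> g ** \<rho> h"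
    and x: "x \<in> lie_elements \<rho>" and y: "y \<in> lie_elements \<rho>"
  shows "bracket x y \<in> lie_elements \<rho>"
  unfolding lie_elements_def
proof (intro CollectI allI impI ballI)
  fix m w
  assume m: "m \<le> CARD('n)" and w: "w \<in> (ext_power m :: ('k, 'n) exterior set)"
  have AB: "alg_A \<rho> z v = alg_B \<rho> z v" if "z \<in> {x, y}" "v \<in> ext_power m" for z v
    using x y m that by (auto simp: lie_elements_def)
  have "alg_A \<rho> (bracket x y) w = alg_A \<rho> x (alg_A \<rho> y w) - alg_A \<rho> y (alg_A \<rho> x w)"
    by (simp add: bracket_def alg_A_diff alg_A_gmult[OF \<rho> w])
  also have "\<dots> = alg_B \<rho> x (alg_B \<rho> y w) - alg_B \<rho> y (alg_B \<rho> x w)"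
    by (simp add: AB w alg_B_in_ext_power)
  finally show "alg_A \<rho> (bracket x y) w = alg_B \<rho> (bracket x y) w"
    by (simp add: alg_B_bracket[OF \<rho> w])
qed

section \<open>Transpositions in the permutation representation\<close>

lemma perm_rep_vec_nth:
  "(perm_rep \<sigma> *v (v :: 'k::field ^ 'n::finite)) $ i = v $ (apply (inverse \<sigma>) i)"
proof -
  have "(perm_rep \<sigma> *v v) $ i = (\<Sum>j\<in>UNIV. if j = apply (inverse \<sigma>) i then v $ j else 0)"
    unfolding matrix_vector_mult_def perm_rep_def vec_lambda_beta
    by (rule sum.cong) (auto simp: apply_inverse bij_inv_eq_iff[OF bij_apply])
  then show ?thesis by simp
qed

lemma perm_rep_one: "perm_rep 1 = mat 1"
  by (simp add: perm_rep_def mat_def)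

text \<open>The swap is the reflection with form \<open>v $ a - v $ b\<close> and vector
  \<open>axis a 1 - axis b 1\<close>; for \<open>a = b\<close> both vanish.\<close>

lemma one_minus_swap_lie: "gelem 1 - gelem (Perm.swap a b) \<in> perm_lie"
proof -
  have "perm_rep (Perm.swap a b) *v v = v - (v $ a - v $ b) *s (axis a 1 - axis b 1)"
    for v :: "complex ^ 'a"
    by (auto simp: vec_eq_iff perm_rep_vec_nth axis_def)
  from ext_one_minus_reflection[OF this] show ?thesis
    by (simp add: perm_lie_def lie_elements_def alg_A_diff alg_B_diff perm_rep_one)
qed

section \<open>The symmetric group on three letters\<close>

definition t12 :: "3 perm" where "t12 = Perm.cycle [1, 2]"
definition t13 :: "3 perm" where "t13 = Perm.cycle [1, 3]"
definition t23 :: "3 perm" where "t23 = Perm.cycle [2, 3]"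
definition c123 :: "3 perm" where "c123 = Perm.cycle [1, 2, 3]"
definition c132 :: "3 perm" where "c132 = Perm.cycle [1, 3, 2]"

lemmas S3_defs = t12_def t13_def t23_def c123_def c132_def

lemma apply_S3 [simp]:
  "apply t12 1 = 2" "apply t12 2 = 1" "apply t12 3 = 3"
  "apply t13 1 = 3" "apply t13 2 = 2" "apply t13 3 = 1"
  "apply t23 1 = 1" "apply t23 2 = 3" "apply t23 3 = 2"
  "apply c123 1 = 2" "apply c123 2 = 3" "apply c123 3 = 1"
  "apply c132 1 = 3" "apply c132 2 = 1" "apply c132 3 = 2"
  by (simp_all add: S3_defs apply_times)

lemma S3_eq_iff: "\<sigma> = \<tau> \<longleftrightarrow>
    apply \<sigma> 1 = apply \<tau> 1 \<and> apply \<sigma> 2 = apply \<tau> 2 \<and> apply \<sigma> (3 :: 3) = apply \<tau> 3"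
  by (simp add: perm_eq_iff forall_3)

lemma distinct_S3: "distinct [1, t12, t13, t23, c123, c132]"
  by (simp add: S3_eq_iff)

lemma distinct_S3_simps [simp]:
  "1 \<noteq> t12" "1 \<noteq> t13" "1 \<noteq> t23" "1 \<noteq> c123" "1 \<noteq> c132"
  "t12 \<noteq> 1" "t13 \<noteq> 1" "t23 \<noteq> 1" "c123 \<noteq> 1" "c132 \<noteq> 1"
  "t12 \<noteq> t13" "t12 \<noteq> t23" "t12 \<noteq> c123" "t12 \<noteq> c132"
  "t13 \<noteq> t12" "t13 \<noteq> t23" "t13 \<noteq> c123" "t13 \<noteq> c132"
  "t23 \<noteq> t12" "t23 \<noteq> t13" "t23 \<noteq> c123" "t23 \<noteq> c132"
  "c123 \<noteq> t12" "c123 \<noteq> t13" "c123 \<noteq> t23" "c123 \<noteq> c132"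
  "c132 \<noteq> t12" "c132 \<noteq> t13" "c132 \<noteq> t23" "c132 \<noteq> c123"
  using distinct_S3 by auto

lemma UNIV_S3: "UNIV = {1, t12, t13, t23, c123, c132}"
proof -
  have "\<sigma> \<in> {1, t12, t13, t23, c123, c132}" for \<sigma> :: "3 perm"
  proof -
    \<comment> \<open>Injectivity leaves six of the 27 possible triples of images.\<close>
    have "apply \<sigma> 1 \<noteq> apply \<sigma> 2" "apply \<sigma> 1 \<noteq> apply \<sigma> 3" "apply \<sigma> 2 \<noteq> apply \<sigma> 3"
      using bij_apply[of \<sigma>] by (simp_all add: bij_def inj_eq)
    then show ?thesis
      using exhaust_3[of "apply \<sigma> 1"] exhaust_3[of "apply \<sigma> 2"] exhaust_3[of "apply \<sigma> 3"]
      by (elim disjE) (simp_all add: S3_eq_iff)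
  qed
  then show ?thesis by blast
qed

lemma forall_S3: "(\<forall>\<sigma>. P \<sigma>) \<longleftrightarrow> P 1 \<and> P t12 \<and> P t13 \<and> P t23 \<and> P c123 \<and> P c132"
proof -
  have "(\<forall>\<sigma>. P \<sigma>) \<longleftrightarrow> (\<forall>\<sigma>\<in>UNIV. P \<sigma>)" by simp
  then show ?thesis unfolding UNIV_S3 by simp
qed

lemma sum_S3: "sum f UNIV = f 1 + f t12 + f t13 + f t23 + f c123 + f c132"
  by (simp add: UNIV_S3 add.assoc)

text \<open>In a product the right factor acts first, whence
  \<open>t12 * t23 = c123\<close>.\<close>

lemma mult_S3 [simp]:
  "t12 * t12 = 1" "t12 * t13 = c132" "t12 * t23 = c123" "t12 * c123 = t23" "t12 * c132 = t13"
  "t13 * t12 = c123" "t13 * t13 = 1" "t13 * t23 = c132" "t13 * c123 = t12" "t13 * c132 = t23"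
  "t23 * t12 = c132" "t23 * t13 = c123" "t23 * t23 = 1" "t23 * c123 = t13" "t23 * c132 = t12"
  "c123 * t12 = t13" "c123 * t13 = t23" "c123 * t23 = t12" "c123 * c123 = c132" "c123 * c132 = 1"
  "c132 * t12 = t23" "c132 * t13 = t12" "c132 * t23 = t13" "c132 * c123 = 1" "c132 * c132 = c123"
  by (simp_all add: S3_eq_iff apply_times)

lemma inverse_S3 [simp]:
  "inverse t12 = t12" "inverse t13 = t13" "inverse t23 = t23"
  "inverse c123 = c132" "inverse c132 = c123"
  by (rule perm.inverse_unique; simp)+

lemma sign_apply_mult:
  "sign (apply (\<sigma> * \<tau>)) = sign (apply \<sigma>) * sign (apply (\<tau> :: 'n::finite perm))"
  by (simp add: apply_times sign_compose permutation)

lemma sign_swap: "sign (apply (Perm.swap a b)) = (if a = b then 1 else - 1)"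
proof -
  have "apply (Perm.swap a b) = Transposition.transpose a b"
    by (rule swap.rep_eq)
  then show ?thesis by (simp add: sign_swap_id)
qed

lemma sign_S3 [simp]:
  "sign (apply t12) = - 1" "sign (apply t13) = - 1" "sign (apply t23) = - 1"
  "sign (apply c123) = 1" "sign (apply c132) = 1"
  by (simp_all add: S3_defs sign_apply_mult sign_swap)


section \<open>The group algebra in coordinates\<close>

text \<open>Solving \<open>h * k = g\<close> for \<open>k\<close> leaves a single sum, which
  \<open>sum_S3\<close> and the multiplication table evaluate.\<close>

lemma gmult_nth:
  fixes x y :: "('k::comm_ring_1, 'n::finite perm) galg"
  shows "(x \<star> y) $ g = (\<Sum>h\<in>UNIV. x $ h * y $ (inverse h * g))"
  unfolding gmult_def vec_lambda_beta
  by (rule sum.reindex_bij_witness[where i = "\<lambda>h. (h, inverse h * g)" and j = fst])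
    (auto simp flip: mult.assoc)

lemma gelem_nth: "gelem g $ h = (if h = g then 1 else 0)"
  by (simp add: gelem_def axis_def)

text \<open>Multiplication by a group element on either side only translates the
  coefficients.\<close>

lemma conj_act_nth:
  fixes x :: "('k::comm_ring_1, 'n::finite perm) galg"
  shows "conj_act g x $ h = x $ (inverse g * h * g)"
proof -
  have left: "(gelem g \<star> x) $ h = x $ (inverse g * h)" for h
  proof -
    have "(gelem g \<star> x) $ h = (\<Sum>k\<in>UNIV. if k = g then x $ (inverse k * h) else 0)"
      unfolding gmult_nth by (rule sum.cong) (auto simp: gelem_nth)
    then show ?thesis by simp
  qed
  have *: "inverse k * h = inverse g \<longleftrightarrow> k = h * g" for k
  proof
    assume "inverse k * h = inverse g"
    then have "k * (inverse k * h) * g = k * inverse g * g" by simp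
    then show "k = h * g" by (simp add: mult.assoc) (simp flip: mult.assoc)
  qed (simp add: perm.inverse_distrib_swap mult.assoc)
  have "conj_act g x $ h = (\<Sum>k\<in>UNIV. if k = h * g then x $ (inverse g * k) else 0)"
    unfolding conj_act_def gmult_nth[of "gelem g \<star> x"] left
    by (rule sum.cong) (auto simp: gelem_nth *)
  then show ?thesis by (simp add: mult.assoc)
qed

lemma vec_eq_S3: "x = y \<longleftrightarrow> x $ 1 = y $ 1 \<and> x $ t12 = y $ t12 \<and> x $ t13 = y $ t13 \<and>
    x $ t23 = y $ t23 \<and> x $ c123 = y $ c123 \<and> x $ c132 = y $ c132"
  by (simp add: vec_eq_iff forall_S3)

lemma cyc_S3:
  "cyc [1, 2] = gelem t12" "cyc [1, 3] = gelem t13" "cyc [2, 3] = gelem t23"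
  "cyc [1, 2, 3] = gelem c123" "cyc [1, 3, 2] = gelem c132"
  by (simp_all add: cyc_def S3_defs)

section \<open>The Lie elements on three letters\<close>

abbreviation "L3_gens \<equiv> {gelem 1 - gelem t12, gelem 1 - gelem t23, gelem 1 - gelem t13,
  gelem c123 - gelem c132 :: (complex, 3 perm) galg}"

lemma in_span_L3_gens_iff:
  "x \<in> vec.span L3_gens \<longleftrightarrow> x $ 1 + x $ t12 + x $ t13 + x $ t23 = 0 \<and> x $ c123 + x $ c132 = 0"
    (is "_ \<longleftrightarrow> ?R x")
proof
  assume "x \<in> vec.span L3_gens"
  then show "?R x"
  proof (induction rule: vec.span_induct_alt)
    case (step c y z)
    from step(1) have "?R y" by (auto simp: gelem_nth)
    with step(2) show ?case by simp algebra
  qed simp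
next
  assume R: "?R x"
  \<comment> \<open>Each transposition, and also \<open>c123\<close>, occurs in just one generator,
    which forces the coefficients. The coordinates at \<open>1\<close> and \<open>c132\<close> then
    match by the two conditions.\<close>
  then have "x = (- x $ t12) *s (gelem 1 - gelem t12) + (- x $ t23) *s (gelem 1 - gelem t23)
      + (- x $ t13) *s (gelem 1 - gelem t13) + x $ c123 *s (gelem c123 - gelem c132)"
    by (simp add: vec_eq_S3 gelem_nth) algebra
  also have "\<dots> \<in> vec.span L3_gens"
    by (intro vec.span_add vec.span_scale vec.span_base) auto
  finally show "x \<in> vec.span L3_gens" .
qed

lemma independent_L3_gens: "vec.independent L3_gens"
  by (auto simp: vec.independent_insert vec.span_breakdown_eq vec_eq_S3 gelem_nth)

lemma L3_eq: "L3 = {x. x $ 1 + x $ t12 + x $ t13 + x $ t23 = 0 \<and> x $ c123 + x $ c132 = 0}"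
proof (intro equalityI subsetI)
  fix x assume "x \<in> L3"
  then have lie: "alg_A perm_rep x w = alg_B perm_rep x w" if "w \<in> ext_power 2" for w
    using that by (auto simp: L3_def perm_lie_def lie_elements_def dest: spec[of _ 2])
  \<comment> \<open>\<open>A = B\<close> on \<open>x\<^sub>1 \<and> x\<^sub>2\<close>, read off through a linear form \<open>\<phi>\<close>\<close>
  have minor: "(\<Sum>\<sigma>\<in>UNIV. x $ \<sigma> * (\<phi> (wedge [axis (apply \<sigma> 1) 1, axis (apply \<sigma> 2) 1])
      - \<phi> (wedge [axis (apply \<sigma> 1) 1, axis 2 1]) - \<phi> (wedge [axis 1 1, axis (apply \<sigma> 2) 1]))) = 0"
    if "Vector_Spaces.linear ext_scale (*) \<phi>" for \<phi>
  proof -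
    interpret \<phi>: Vector_Spaces.linear ext_scale "(*)" \<phi> by fact
    have "\<phi> (alg_A perm_rep x (wedge [axis 1 1, axis 2 1]))
        = \<phi> (alg_B perm_rep x (wedge [axis 1 1, axis 2 1]))"
      by (simp add: lie wedge_in_ext_power)
    then show ?thesis
      by (simp add: alg_A_def alg_B_def \<phi>.sum \<phi>.scale \<phi>.add ext_A_wedge ext_B_wedge
          perm_rep_axis lessThan_Suc numeral_2_eq_2 right_diff_distrib sum_subtractf algebra_simps
          sum.distrib)
  qed
  obtain \<phi> \<psi> :: "(complex, 3) exterior \<Rightarrow> complex"
    where \<phi>: "Vector_Spaces.linear ext_scale (*) \<phi>" "\<And>u v. \<phi> (wedge [u, v]) = u $ 1 * v $ 2 - u $ 2 * v $ 1"
      and \<psi>: "Vector_Spaces.linear ext_scale (*) \<psi>" "\<And>u v. \<psi> (wedge [u, v]) = u $ 1 * v $ 3 - u $ 3 * v $ 1"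
    by (metis minor_functional)
  \<comment> \<open>In \<open>minor\<close>, the form \<open>\<phi>\<close> gives weight -1 to the
    identity and the transpositions and 0 to the 3-cycles; for \<open>\<psi>\<close> it is the other
    way round.\<close>
  have "- x $ 1 - x $ t12 - x $ t13 = x $ t23" "- x $ c123 = x $ c132"
    using minor[OF \<phi>(1)] minor[OF \<psi>(1)] by (simp_all add: \<phi>(2) \<psi>(2) sum_S3 axis_def)
  from this[symmetric]
  show "x \<in> {x. x $ 1 + x $ t12 + x $ t13 + x $ t23 = 0 \<and> x $ c123 + x $ c132 = 0}"
    by simp
next
  have swaps: "gelem 1 - gelem t12 \<in> L3" "gelem 1 - gelem t13 \<in> L3" "gelem 1 - gelem t23 \<in> L3"
    by (simp_all add: L3_def S3_defs one_minus_swap_lie)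
  \<comment> \<open>All terms involving the identity cancel, leaving \<open>t12 * t23\<close> minus
    \<open>t23 * t12\<close>.\<close>
  have "bracket (gelem 1 - gelem t12) (gelem 1 - gelem t23)
      = (gelem c123 - gelem c132 :: (complex, 3 perm) galg)"
    by (simp add: bracket_def vec_eq_S3 gmult_nth sum_S3 gelem_nth)
  moreover have "bracket (gelem 1 - gelem t12) (gelem 1 - gelem t23) \<in> L3"
    using swaps by (simp add: L3_def perm_lie_def bracket_lie_elements perm_rep_times)
  ultimately have "gelem c123 - gelem c132 \<in> L3" by simp
  then have "vec.span L3_gens \<subseteq> L3"
    using swaps by (intro vec.span_minimal) (auto simp: L3_def perm_lie_def subspace_lie_elements)
  then show "x \<in> L3" if "x \<in> {x. x $ 1 + x $ t12 + x $ t13 + x $ t23 = 0 \<and> x $ c123 + x $ c132 = 0}"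
    for x
    using that in_span_L3_gens_iff[of x] by auto
qed

section \<open>The summands in coordinates\<close>

lemma V0_eq: "V0 = {x. x $ t12 = - (x $ 1) / 3 \<and> x $ t13 = - (x $ 1) / 3 \<and> x $ t23 = - (x $ 1) / 3
    \<and> x $ c123 = 0 \<and> x $ c132 = 0}"
  by (auto simp: V0_def cyc_S3 vec.span_singleton image_iff vec_eq_S3 gelem_nth)

lemma V1_eq: "V1 = {x. x $ 1 = 0 \<and> x $ t12 = 0 \<and> x $ t13 = 0 \<and> x $ t23 = 0 \<and> x $ c123 + x $ c132 = 0}"
  by (auto simp: V1_def cyc_S3 vec.span_singleton image_iff vec_eq_S3 gelem_nth
      eq_neg_iff_add_eq_0 add.commute intro: exI[of _ "_ $ c123"])


text \<open>The span of each pair lies in that of all three, which lies in \<open>W\<close>; writing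
  the elements of \<open>W\<close> in terms of each pair closes the circle.\<close>

lemma span_transposition_differences:
  fixes S W
  defines "W \<equiv> {x :: (complex, 3 perm) galg.
    x $ 1 = 0 \<and> x $ t12 + x $ t13 + x $ t23 = 0 \<and> x $ c123 = 0 \<and> x $ c132 = 0}"
  shows "vec.span {gelem t12 - gelem t13, gelem t13 - gelem t23} = W"
    and "vec.span {gelem t13 - gelem t23, gelem t23 - gelem t12} = W"
    and "vec.span {gelem t23 - gelem t12, gelem t12 - gelem t13} = W"
    and "vec.span {gelem t12 - gelem t13, gelem t13 - gelem t23, gelem t23 - gelem t12} = W"
proof -
  let ?a = "gelem t12 - gelem t13 :: (complex, 3 perm) galg"
  let ?b = "gelem t13 - gelem t23 :: (complex, 3 perm) galg"
  let ?c = "gelem t23 - gelem t12 :: (complex, 3 perm) galg"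
  have "vec.subspace W"
    unfolding W_def vec.subspace_def by simp algebra
  then have sub: "vec.span {?a, ?b, ?c} \<subseteq> W"
    by (intro vec.span_minimal) (auto simp: W_def gelem_nth)
  have W: "W \<subseteq> vec.span {u, v}" if "\<And>x. x \<in> W \<Longrightarrow> \<exists>s t. x = s *s u + t *s v" for u v
  proof
    fix x assume "x \<in> W"
    from that[OF this] show "x \<in> vec.span {u, v}"
      by (auto intro!: vec.span_add vec.span_scale intro: vec.span_base)
  qed
  have "W \<subseteq> vec.span {?a, ?b}"
  proof (rule W)
    fix x assume "x \<in> W"
    \<comment> \<open>\<open>t12\<close> occurs only in \<open>?a\<close> and \<open>t23\<close>
      only in \<open>?b\<close>; the coefficient at \<open>t13\<close> is right because the three
      sum to zero. The other pairs are cyclic shifts.\<close>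
    then have "x = x $ t12 *s ?a + (- x $ t23) *s ?b"
      unfolding W_def vec_eq_S3 by (simp add: gelem_nth) algebra
    then show "\<exists>s t. x = s *s ?a + t *s ?b" by blast
  qed
  moreover have "W \<subseteq> vec.span {?b, ?c}"
  proof (rule W)
    fix x assume "x \<in> W"
    then have "x = x $ t13 *s ?b + (- x $ t12) *s ?c"
      unfolding W_def vec_eq_S3 by (simp add: gelem_nth) algebra
    then show "\<exists>s t. x = s *s ?b + t *s ?c" by blast
  qed
  moreover have "W \<subseteq> vec.span {?c, ?a}"
  proof (rule W)
    fix x assume "x \<in> W"
    then have "x = x $ t23 *s ?c + (- x $ t13) *s ?a"
      unfolding W_def vec_eq_S3 by (simp add: gelem_nth) algebra
    then show "\<exists>s t. x = s *s ?c + t *s ?a" by blast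
  qed
  moreover have "vec.span {?a, ?b} \<subseteq> vec.span {?a, ?b, ?c}" "vec.span {?b, ?c} \<subseteq> vec.span {?a, ?b, ?c}"
    "vec.span {?c, ?a} \<subseteq> vec.span {?a, ?b, ?c}"
    by (auto intro!: vec.span_mono)
  ultimately show "vec.span {?a, ?b} = W" "vec.span {?b, ?c} = W" "vec.span {?c, ?a} = W"
    "vec.span {?a, ?b, ?c} = W"
    using sub by auto
qed

lemma V2_eq: "V2 = {x. x $ 1 = 0 \<and> x $ t12 + x $ t13 + x $ t23 = 0 \<and> x $ c123 = 0 \<and> x $ c132 = 0}"
  unfolding V2_def cyc_S3 by (rule span_transposition_differences)

lemma is_basis_V2:
  "is_basis {gelem t12 - gelem t13, gelem t13 - gelem t23} V2"
  "is_basis {gelem t13 - gelem t23, gelem t23 - gelem t12} V2"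
  "is_basis {gelem t23 - gelem t12, gelem t12 - gelem t13} V2"
  unfolding is_basis_def V2_eq span_transposition_differences
  by (auto simp: vec.independent_insert vec.span_breakdown_eq vec_eq_S3 gelem_nth)

lemma span_V1_V2_eq:
  "vec.span (V1 \<union> V2) = {x. x $ 1 = 0 \<and> x $ t12 + x $ t13 + x $ t23 = 0 \<and> x $ c123 + x $ c132 = 0}"
    (is "_ = ?W")
proof (intro equalityI subsetI)
  have "vec.subspace ?W"
    unfolding vec.subspace_def by simp algebra
  then have "vec.span (V1 \<union> V2) \<subseteq> ?W"
    by (intro vec.span_minimal) (auto simp: V1_eq V2_eq)
  then show "x \<in> ?W" if "x \<in> vec.span (V1 \<union> V2)" for x
    using that by blast
next
  fix x assume x: "x \<in> ?W"
  \<comment> \<open>The 3-cycle part of \<open>x\<close>, which lies in \<open>V1\<close>; the rest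
    is supported on transpositions.\<close>
  let ?u = "x $ c123 *s (gelem c123 - gelem c132)"
  have "?u \<in> V1" "x - ?u \<in> V2"
    using x by (simp_all add: V1_eq V2_eq gelem_nth add.commute)
  then have "?u + (x - ?u) \<in> vec.span (V1 \<union> V2)"
    by (intro vec.span_add vec.span_base) auto
  then show "x \<in> vec.span (V1 \<union> V2)" by simp
qed

section \<open>Bases and dimensions\<close>

lemma dim_is_basis: "is_basis B W \<Longrightarrow> vec.dim W = card B"
  unfolding is_basis_def using vec.dim_span_eq_card_independent by blast

lemma is_basis_L3: "is_basis L3_gens L3"
  unfolding is_basis_def L3_eq using independent_L3_gens by (auto simp: in_span_L3_gens_iff)

lemma is_basis_span_V1_V2:
  "is_basis {gelem c123 - gelem c132, gelem t12 - gelem t13, gelem t13 - gelem t23}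
    (vec.span (V1 \<union> V2))" (is "is_basis (insert ?c ?B) _")
  unfolding is_basis_def
proof
  show "vec.independent (insert ?c ?B)"
    by (auto simp: vec.independent_insert vec.span_breakdown_eq vec_eq_S3 gelem_nth)
  have "vec.span (vec.span {?c} \<union> vec.span ?B) = vec.span ({?c} \<union> ?B)"
    by (simp only: vec.span_Un vec.span_span)
  then show "vec.span (insert ?c ?B) = vec.span (V1 \<union> V2)"
    using span_transposition_differences(1) by (simp add: V1_def cyc_S3 V2_eq insert_commute)
qed

section \<open>Criteria for direct sums\<close>

text \<open>Subtracting two decompositions of the same vector reduces uniqueness to decompositions
  of 0.\<close>

lemma direct_sum_2I:
  assumes "vec.subspace U" "vec.subspace V"
    and W: "W = {u + v | u v. u \<in> U \<and> v \<in> V}"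
    and indep: "\<And>u v. u \<in> U \<Longrightarrow> v \<in> V \<Longrightarrow> u + v = 0 \<Longrightarrow> u = 0 \<and> v = 0"
  shows "direct_sum W [U, V]"
proof -
  have "u = u' \<and> v = v'" if "u \<in> U" "u' \<in> U" "v \<in> V" "v' \<in> V" "u + v = u' + v'" for u u' v v'
  proof -
    have "(u - u') + (v - v') = 0" using that by (simp add: algebra_simps)
    then show ?thesis
      using indep[of "u - u'" "v - v'"] that assms(1,2) by (simp add: vec.subspace_diff)
  qed
  then have "inj_on sum_list (listset [U, V])"
    by (fastforce simp: inj_on_def set_Cons_def)
  moreover have "sum_list ` listset [U, V] = W"
    by (force simp: W set_Cons_def image_def)
  ultimately show ?thesis
    using assms(1,2) by (simp add: direct_sum_def bij_betw_def)
qed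

lemma direct_sum_3I:
  assumes "vec.subspace U" "vec.subspace V" "vec.subspace X"
    and W: "W = {u + v + x | u v x. u \<in> U \<and> v \<in> V \<and> x \<in> X}"
    and indep: "\<And>u v x. u \<in> U \<Longrightarrow> v \<in> V \<Longrightarrow> x \<in> X \<Longrightarrow> u + v + x = 0 \<Longrightarrow> u = 0 \<and> v = 0 \<and> x = 0"
  shows "direct_sum W [U, V, X]"
proof -
  have "u = u' \<and> v = v' \<and> x = x'"
    if "u \<in> U" "u' \<in> U" "v \<in> V" "v' \<in> V" "x \<in> X" "x' \<in> X" "u + (v + x) = u' + (v' + x')"
    for u u' v v' x x'
  proof -
    have "(u - u') + (v - v') + (x - x') = 0" using that by (simp add: algebra_simps)
    then show ?thesis
      using indep[of "u - u'" "v - v'" "x - x'"] that assms(1-3) by (simp add: vec.subspace_diff)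
  qed
  then have "inj_on sum_list (listset [U, V, X])"
    by (fastforce simp: inj_on_def set_Cons_def)
  moreover have "sum_list ` listset [U, V, X] = W"
    by (force simp: W set_Cons_def image_def add.assoc)
  ultimately show ?thesis
    using assms(1-3) by (simp add: direct_sum_def bij_betw_def)
qed

section \<open>The conjugation action\<close>

lemma subspace_V: "vec.subspace V0" "vec.subspace V1" "vec.subspace V2"
  by (simp_all add: V0_def V1_def V2_def)

lemma subspace_L3: "vec.subspace L3"
  by (simp add: L3_def perm_lie_def subspace_lie_elements)

text \<open>Both equations defining \<open>L3\<close> sum coefficients over unions of conjugacy
  classes. The quantifier over \<open>\<sigma>\<close> is put into the goal so that
  \<open>forall_S3\<close> can split it.\<close>

lemma conj_act_L3: "x \<in> L3 \<Longrightarrow> conj_act \<sigma> x \<in> L3"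
proof -
  have "\<forall>\<sigma>. x \<in> L3 \<longrightarrow> conj_act \<sigma> x \<in> L3"
    by (simp add: forall_S3 L3_eq conj_act_nth ac_simps)
  then show "x \<in> L3 \<Longrightarrow> conj_act \<sigma> x \<in> L3" by blast
qed

text \<open>Elements of \<open>V0\<close> are constant on conjugacy classes.\<close>

lemma conj_act_V0: "x \<in> V0 \<Longrightarrow> conj_act \<sigma> x = x"
proof -
  have "\<forall>\<sigma>. x \<in> V0 \<longrightarrow> conj_act \<sigma> x = x"
    by (simp add: forall_S3 V0_eq conj_act_nth vec_eq_S3)
  then show "x \<in> V0 \<Longrightarrow> conj_act \<sigma> x = x" by blast
qed

text \<open>Transpositions exchange the two 3-cycles, whose coefficients are opposite; even
  permutations fix both.\<close>

lemma conj_act_V1: "x \<in> V1 \<Longrightarrow> conj_act \<sigma> x = of_int (sign (apply \<sigma>)) *s x"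
proof -
  have "\<forall>\<sigma>. x \<in> V1 \<longrightarrow> conj_act \<sigma> x = of_int (sign (apply \<sigma>)) *s x"
    by (auto simp: forall_S3 V1_eq conj_act_nth vec_eq_S3 add_eq_0_iff)
  then show "x \<in> V1 \<Longrightarrow> conj_act \<sigma> x = of_int (sign (apply \<sigma>)) *s x" by blast
qed

lemma conj_act_V2: "x \<in> V2 \<Longrightarrow> conj_act \<sigma> x \<in> V2"
proof -
  have "\<forall>\<sigma>. x \<in> V2 \<longrightarrow> conj_act \<sigma> x \<in> V2"
    by (simp add: forall_S3 V2_eq conj_act_nth ac_simps)
  then show "x \<in> V2 \<Longrightarrow> conj_act \<sigma> x \<in> V2" by blast
qed

lemma conj_subreps: "conj_subrep L3" "conj_subrep V0" "conj_subrep V1" "conj_subrep V2"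
  by (simp_all add: conj_subrep_def subspace_L3 subspace_V conj_act_L3 conj_act_V0 conj_act_V1
      conj_act_V2 vec.subspace_scale)

lemma direct_sum_V: "direct_sum L3 [V0, V1, V2]"
proof (rule direct_sum_3I)
  show "L3 = {u + v + x | u v x. u \<in> V0 \<and> v \<in> V1 \<and> x \<in> V2}"
  proof (intro equalityI subsetI)
    fix x assume x: "x \<in> L3"
    \<comment> \<open>\<open>?u\<close> matches the coefficient at \<open>1\<close> and
      \<open>?v\<close> those at the 3-cycles; the remainder lives on the transpositions.\<close>
    let ?u = "x $ 1 *s (gelem 1 - (1/3) *s gelem t12 - (1/3) *s gelem t13 - (1/3) *s gelem t23)"
    let ?v = "x $ c123 *s (gelem c123 - gelem c132)"
    have coords: "x $ 1 = - x $ t12 - x $ t13 - x $ t23" "x $ c132 = - x $ c123"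
      using x by (simp_all add: L3_eq eq_neg_iff_add_eq_0 algebra_simps)
    have "?u \<in> V0" "?v \<in> V1" "x - ?u - ?v \<in> V2"
      by (simp_all add: V0_eq V1_eq V2_eq gelem_nth coords field_simps)
    moreover have "x = ?u + ?v + (x - ?u - ?v)" by simp
    ultimately show "x \<in> {u + v + x | u v x. u \<in> V0 \<and> v \<in> V1 \<and> x \<in> V2}" by blast
  next
    fix y assume "y \<in> {u + v + x | u v x. u \<in> V0 \<and> v \<in> V1 \<and> x \<in> V2}"
    then obtain u v x where y: "y = u + v + x" and "u \<in> V0" "v \<in> V1" "x \<in> V2" by blast
    then have "u \<in> L3" "v \<in> L3" "x \<in> L3"
      by (simp_all add: V0_eq V1_eq V2_eq L3_eq)
    then show "y \<in> L3"
      using subspace_L3 by (simp add: y vec.subspace_add)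
  qed
  \<comment> \<open>Only \<open>u\<close> has a coefficient at \<open>1\<close> and only
    \<open>v\<close> has any at the 3-cycles, so the three vanish in turn.\<close>
  show "u = 0 \<and> v = 0 \<and> x = 0" if "u \<in> V0" "v \<in> V1" "x \<in> V2" "u + v + x = 0" for u v x
    using that by (auto simp: V0_eq V1_eq V2_eq vec_eq_S3)
qed (fact subspace_V)+

lemma dim_V0: "vec.dim V0 = 1"
proof -
  have "gelem 1 - (1/3) *s gelem t12 - (1/3) *s gelem t13 - (1/3) *s gelem t23
      \<noteq> (0 :: (complex, 3 perm) galg)"
    by (simp add: vec_eq_S3 gelem_nth)
  then show ?thesis
    by (simp add: V0_def cyc_S3 vec.dim_eq_card_independent)
qed

lemma dim_V1: "vec.dim V1 = 1"
proof -
  have "gelem c123 - gelem c132 \<noteq> (0 :: (complex, 3 perm) galg)"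
    by (simp add: vec_eq_S3 gelem_nth)
  then show ?thesis
    by (simp add: V1_def cyc_S3 vec.dim_eq_card_independent)
qed

section \<open>The Lie algebra structure\<close>

text \<open>Coefficient sums over conjugacy classes vanish on commutators, whatever \<open>x\<close> and \<open>y\<close>.\<close>

lemma bracket_in_span_V1_V2: "bracket x y \<in> vec.span (V1 \<union> V2)"
  unfolding span_V1_V2_eq
  by (simp add: bracket_def gmult_nth sum_S3 algebra_simps)

lemma lie_center_L3: "lie_center L3 = V0"
proof (intro equalityI subsetI)
  fix z assume "z \<in> lie_center L3"
  then have z: "z \<in> L3" and comm: "\<And>x. x \<in> L3 \<Longrightarrow> bracket z x = 0"
    by (auto simp: lie_center_def)
  \<comment> \<open>These three coefficients make \<open>z\<close> constant on the transpositions
    and on the 3-cycles; membership in \<open>L3\<close> then puts it into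
    \<open>V0\<close>.\<close>
  have "bracket z (gelem 1 - gelem t12) $ c123 = z $ t23 - z $ t13"
    "bracket z (gelem 1 - gelem t13) $ c123 = z $ t12 - z $ t23"
    "bracket z (gelem 1 - gelem t12) $ t13 = z $ c132 - z $ c123"
    by (simp_all add: bracket_def gmult_nth sum_S3 gelem_nth)
  moreover have "gelem 1 - gelem t12 \<in> L3" "gelem 1 - gelem t13 \<in> L3"
    by (simp_all add: L3_eq gelem_nth)
  ultimately have eqs: "z $ t13 = z $ t23" "z $ t12 = z $ t23" "z $ c132 = z $ c123"
    using comm by simp_all
  have "z $ 1 + 3 * z $ t23 = 0" "z $ c123 = 0"
    using z by (simp_all add: L3_eq eqs algebra_simps)
  then have "z $ 1 = - 3 * z $ t23" "z $ c123 = 0"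
    by (simp_all add: eq_neg_iff_add_eq_0)
  then show "z \<in> V0"
    by (simp add: V0_eq eqs)
next
  fix z assume z: "z \<in> V0"
  then have coords: "z $ t12 = z $ t23" "z $ t13 = z $ t23" "z $ c123 = 0" "z $ c132 = 0"
    by (simp_all add: V0_eq)
  \<comment> \<open>As a class function, \<open>z\<close> commutes with the whole group
    algebra.\<close>
  have "bracket z x = 0" for x
    by (simp add: coords bracket_def vec_eq_S3 gmult_nth sum_S3 algebra_simps)
  moreover have "z \<in> L3" using z by (simp add: V0_eq L3_eq)
  ultimately show "z \<in> lie_center L3" by (simp add: lie_center_def)
qed

lemma lie_subalgebras: "lie_subalgebra L3" "lie_subalgebra V0" "lie_subalgebra (vec.span (V1 \<union> V2))"
proof -
  show "lie_subalgebra L3"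
    using subspace_L3
    by (simp add: lie_subalgebra_def L3_def perm_lie_def bracket_lie_elements perm_rep_times)
  show "lie_subalgebra V0"
    unfolding lie_subalgebra_def
  proof (intro conjI ballI)
    fix x y assume "x \<in> V0" "y \<in> V0"
    then have "bracket x y = 0"
      using lie_center_L3 unfolding lie_center_def by blast
    then show "bracket x y \<in> V0"
      using subspace_V(1) by (simp add: vec.subspace_0)
  qed (rule subspace_V)
  show "lie_subalgebra (vec.span (V1 \<union> V2))"
    by (simp add: lie_subalgebra_def bracket_in_span_V1_V2)
qed

lemma lie_direct_sum_L3: "lie_direct_sum L3 [V0, vec.span (V1 \<union> V2)]"
proof -
  let ?M = "vec.span (V1 \<union> V2)"
  have ds: "direct_sum L3 [V0, ?M]"
  proof (rule direct_sum_2I)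
    show "L3 = {u + v | u v. u \<in> V0 \<and> v \<in> ?M}"
    proof (intro equalityI subsetI)
      fix x assume x: "x \<in> L3"
      let ?u = "x $ 1 *s (gelem 1 - (1/3) *s gelem t12 - (1/3) *s gelem t13 - (1/3) *s gelem t23)"
      have coords: "x $ 1 = - x $ t12 - x $ t13 - x $ t23" "x $ c132 = - x $ c123"
        using x by (simp_all add: L3_eq eq_neg_iff_add_eq_0 algebra_simps)
      have "?u \<in> V0" "x - ?u \<in> ?M"
        by (simp_all add: V0_eq span_V1_V2_eq gelem_nth coords field_simps)
      moreover have "x = ?u + (x - ?u)" by simp
      ultimately show "x \<in> {u + v | u v. u \<in> V0 \<and> v \<in> ?M}" by blast
    next
      fix y assume "y \<in> {u + v | u v. u \<in> V0 \<and> v \<in> ?M}"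
      then obtain u v where y: "y = u + v" and "u \<in> V0" "v \<in> ?M" by blast
      then have "u \<in> L3" "v \<in> L3"
        by (simp_all add: V0_eq span_V1_V2_eq L3_eq)
      then show "y \<in> L3"
        using subspace_L3 by (simp add: y vec.subspace_add)
    qed
    show "u = 0 \<and> v = 0" if "u \<in> V0" "v \<in> ?M" "u + v = 0" for u v
      using that by (auto simp: V0_eq span_V1_V2_eq vec_eq_S3)
  qed (simp_all add: subspace_V)
  \<comment> \<open>\<open>?M\<close> lies in \<open>L3\<close>, and \<open>V0\<close> is the center
    of \<open>L3\<close>.\<close>
  have "bracket u v = 0" "bracket v u = 0" if "u \<in> V0" "v \<in> ?M" for u v
  proof -
    have "v \<in> L3" using that by (simp add: span_V1_V2_eq L3_eq)
    then show "bracket u v = 0"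
      using that lie_center_L3 by (auto simp: lie_center_def)
    then show "bracket v u = 0" by (simp add: bracket_def)
  qed
  with ds show ?thesis
    by (auto simp: lie_direct_sum_def lie_subalgebras less_Suc_eq)
qed

theorem mainTheorem5:
  shows
    "is_basis {gelem 1 - cyc [1, 2], gelem 1 - cyc [2, 3], gelem 1 - cyc [1, 3],
        cyc [1, 2, 3] - cyc [1, 3, 2]} L3
     \<and> distinct [gelem 1 - cyc [1, 2], gelem 1 - cyc [2, 3], gelem 1 - cyc [1, 3],
        cyc [1, 2, 3] - cyc [1, 3, 2 :: 3]]
     \<and> vec.dim L3 = 4

     \<and> conj_subrep L3 \<and> conj_subrep V0 \<and> conj_subrep V1 \<and> conj_subrep V2
     \<and> direct_sum L3 [V0, V1, V2]
     \<and> vec.dim V0 = 1 \<and> (\<forall>\<sigma>. \<forall>x\<in>V0. conj_act \<sigma> x = x)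
     \<and> vec.dim V1 = 1 \<and> (\<forall>\<sigma>. \<forall>x\<in>V1. conj_act \<sigma> x = of_int (sign (apply \<sigma>)) *s x)
     \<and> vec.dim V2 = 2
     \<and> (cyc [1, 2] - cyc [1, 3]) + (cyc [1, 3] - cyc [2, 3]) + (cyc [2, 3] - cyc [1, 2 :: 3]) = 0
     \<and> distinct [cyc [1, 2] - cyc [1, 3], cyc [1, 3] - cyc [2, 3], cyc [2, 3] - cyc [1, 2 :: 3]]
     \<and> is_basis {cyc [1, 2] - cyc [1, 3], cyc [1, 3] - cyc [2, 3]} V2
     \<and> is_basis {cyc [1, 3] - cyc [2, 3], cyc [2, 3] - cyc [1, 2]} V2
     \<and> is_basis {cyc [2, 3] - cyc [1, 2], cyc [1, 2] - cyc [1, 3]} V2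

     \<and> lie_subalgebra L3
     \<and> lie_center L3 = V0
     \<and> lie_subalgebra (vec.span (V1 \<union> V2))
     \<and> vec.dim (vec.span (V1 \<union> V2)) = 3
     \<and> lie_direct_sum L3 [lie_center L3, vec.span (V1 \<union> V2)]"
proof -
  \<comment> \<open>\<open>dim_is_basis\<close> counts a basis as a set, so its vectors must be
    shown to differ.\<close>
  have distinct_gens: "distinct [gelem 1 - gelem t12, gelem 1 - gelem t23, gelem 1 - gelem t13,
      gelem c123 - gelem c132 :: (complex, 3 perm) galg]"
    by (simp add: vec_eq_S3 gelem_nth)
  have distinct_diffs: "distinct [gelem t12 - gelem t13, gelem t13 - gelem t23,
      gelem t23 - gelem t12 :: (complex, 3 perm) galg]"
    by (simp add: vec_eq_S3 gelem_nth)
  have "gelem c123 - gelem c132 \<notin> {gelem t12 - gelem t13, gelem t13 - gelem t23 :: (complex, 3 perm) galg}"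
    by (simp add: vec_eq_S3 gelem_nth)
  then have dims: "vec.dim L3 = 4" "vec.dim V2 = 2" "vec.dim (vec.span (V1 \<union> V2)) = 3"
    using distinct_gens distinct_diffs
    by (simp_all add: dim_is_basis[OF is_basis_L3] dim_is_basis[OF is_basis_V2(1)]
        dim_is_basis[OF is_basis_span_V1_V2] del: vec.dim_span)
  show ?thesis
    unfolding cyc_S3 lie_center_L3
    by (intro conjI allI ballI is_basis_L3 distinct_gens dims conj_subreps direct_sum_V dim_V0
        conj_act_V0 dim_V1 conj_act_V1 distinct_diffs is_basis_V2 lie_subalgebras refl
        lie_direct_sum_L3) simp_all
qed

end
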